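(* Let $I\subseteq[-\infty,\infty]$ be an interval, let $c\in I$, and let $f,g\colon I\to\mathbb{R}$ be two functions such that (i) $f$ and $g$ are both locally Lebesgue integrable on $I$, and (ii) $g$ preserves Lebesgue-almost everywhere a non-zero sign. If $\frac{f}{g}\colon I\to[-\infty,\infty]$ is Lebesgue-almost everywhere monotonic (respectively, Lebesgue-almost everywhere strictly monotonic), then the function $$I\setminus\{c\}\to\mathbb{R},\qquad x\mapsto \frac{\int_c^x f(t)\,\mathrm{d}t}{\int_c^x g(t)\,\mathrm{d}t},$$ is monotonic (respectively, strictly monotonic) on $I\setminus\{c\}$, of the same monotonicity: it is increasing, decreasing, strictly increasing or strictly decreasing whenever $\frac{f}{g}$ is so Lebesgue-almost everywhere.
   Context: Intervals may be subsets of the extended real line $[-\infty,\infty]$ and may contain $\pm\infty$. A function on an interval $I\subseteq[-\infty,\infty]$ has a property locally if it has it on every compact subinterval of $I$; unbounded intervals of the form $[-\infty,\infty]$, $[-\infty,a]$, $[a,\infty]$ with $a\in\mathbb{R}$ are compact. Thus $f$ is locally Lebesgue integrable on $I$ if it is Lebesgue integrable on every compact subinterval of $I$ (the points $\pm\infty$ have measure zero). "$g$ preserves Lebesgue-almost everywhere a non-zero sign" means that either $g>0$ almost everywhere on $I$ or $g<0$ almost everywhere on $I$. A function is Lebesgue-almost everywhere (strictly) monotonic on $I$ if its restriction to the complement in $I$ of some Lebesgue-null set is (strictly) monotonic; the values of $f/g$ on the null set where $g=0$ are irrelevant. "Increasing" and "decreasing" without "strictly" are in the weak sense. Integrals are oriented: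 $\int_c^x=-\int_x^c$. *)

theory Defs
  imports "HOL-Analysis.Analysis"
begin

text \<open>
  Sets of extended reals are measured through their real part, so that the points
  \<open>\<infinity>\<close> and \<open>-\<infinity>\<close> have measure zero.  Functions on an interval are total functions
  of type \<open>ereal \<Rightarrow> real\<close> of which only the values on that interval are used.
\<close>

definition ereal_interval :: "ereal set \<Rightarrow> bool" where
  "ereal_interval I \<longleftrightarrow> (\<forall>a\<in>I. \<forall>b\<in>I. {a..b} \<subseteq> I)"

text \<open>The compact intervals of extended reals are the sets \<open>{a..b}\<close>, infinite end points included.\<close>

definition locally_lebesgue_integrable :: "ereal set \<Rightarrow> (ereal \<Rightarrow> real) \<Rightarrow> bool" where
  "locally_lebesgue_integrable I f \<longleftrightarrow>
     (\<forall>a b. {a..b} \<subseteq> I \<longrightarrow> set_integrable lebesgue (ereal -` {a..b}) (\<lambda>t. f (ereal t)))"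

definition ae_nonzero_sign :: "ereal set \<Rightarrow> (ereal \<Rightarrow> real) \<Rightarrow> bool" where
  "ae_nonzero_sign I g \<longleftrightarrow>
     (AE t in lebesgue. ereal t \<in> I \<longrightarrow> g (ereal t) > 0) \<or>
     (AE t in lebesgue. ereal t \<in> I \<longrightarrow> g (ereal t) < 0)"

definition ae_restricted :: "ereal set \<Rightarrow> (ereal set \<Rightarrow> bool) \<Rightarrow> bool" where
  "ae_restricted I P \<longleftrightarrow> (\<exists>N. ereal -` N \<in> null_sets lebesgue \<and> P (I - N))"

text \<open>
  The values at zeros of \<open>g\<close> are conventional; under \<open>ae_nonzero_sign\<close> they
  can be absorbed into the exceptional null set.
\<close>

definition pointwise_quotient :: "(ereal \<Rightarrow> real) \<Rightarrow> (ereal \<Rightarrow> real) \<Rightarrow> ereal \<Rightarrow> ereal" where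
  "pointwise_quotient f g x = ereal (f x) / ereal (g x)"

text \<open>The interval integral of the library is oriented: it changes sign when \<open>x < c\<close>.\<close>

definition integral_quotient ::
    "ereal \<Rightarrow> (ereal \<Rightarrow> real) \<Rightarrow> (ereal \<Rightarrow> real) \<Rightarrow> ereal \<Rightarrow> real" where
  "integral_quotient c f g x =
     (LINT t=c..x|lebesgue. f (ereal t)) / (LINT t=c..x|lebesgue. g (ereal t))"

end

theory Submission
  imports Defs
begin

text \<open>
  Suppose that \<open>g > 0\<close> and that \<open>h = f / g\<close> is increasing.  On an interval with end points \<open>a < b\<close>
  the quotient of the integrals of \<open>f\<close> and \<open>g\<close> is the mean \<open>M a b\<close> of \<open>h\<close> with respect to the
  measure with density \<open>g\<close>.  It is the same number for either orientation of the integrals, so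
  the function to be studied is \<open>x \<mapsto> M (min c x) (max c x)\<close>.

  If \<open>a < b < d\<close>, the supremum \<open>m\<close> of \<open>h\<close> on the left part separates the two parts:
  \<open>f \<le> m g\<close> to the left of \<open>b\<close> and \<open>f \<ge> m g\<close> to the right of it (\<open>integrals_separated\<close>).
  Hence \<open>M a b \<le> m \<le> M b d\<close>.  As \<open>M a d\<close> is a convex combination of \<open>M a b\<close> and \<open>M b d\<close>, it
  lies between them (\<open>mean_between\<close>): a mean grows when either end point moves to the right.
  Moving one end point while the other stays at \<open>c\<close> compares two points \<open>x < y\<close> on the same
  side of \<open>c\<close>; for \<open>x < c < y\<close> one passes through \<open>M x y\<close>, since \<open>M x c \<le> M x y \<le> M c y\<close>.
  If \<open>h\<close> is strictly increasing, it stays below its supremum \<open>m\<close> on the open left part, so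
  \<open>M a b < m \<le> M b d\<close>, and \<open>M a d\<close> lies strictly between \<open>M a b\<close> and \<open>M b d\<close>.

  The remaining cases follow by changing signs: replacing \<open>f\<close> and \<open>g\<close> by \<open>-f\<close> and \<open>-g\<close>
  changes neither quotient and makes \<open>g\<close> positive, and replacing \<open>f\<close> by \<open>-f\<close> exchanges
  increasing and decreasing.
\<close>

section \<open>Integrals over open intervals with extended real end points\<close>

lemma einterval_emeasure_nonzero:
  assumes "a < b"
  shows "emeasure lebesgue (einterval a b) \<noteq> 0"
proof -
  have "einterval a b \<noteq> {}"
    using einterval_nonempty[OF assms] by auto
  then have "\<not> negligible (einterval a b)"
    by (intro open_not_negligible) auto
  then show ?thesis
    by (auto simp: negligible_iff_null_sets null_sets_def)
qed

lemma AE_einterval_witness: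
  assumes "a < b" and "AE t in lebesgue. t \<in> einterval a b \<longrightarrow> t \<in> T"
  obtains t where "t \<in> einterval a b" and "t \<in> T"
proof (cases "einterval a b \<inter> T = {}")
  case True
  then have "AE t in lebesgue. t \<notin> einterval a b"
    using assms(2) by (auto elim!: eventually_mono)
  then have "einterval a b \<in> null_sets lebesgue"
    by (subst AE_iff_null_sets) auto
  then show ?thesis
    using einterval_emeasure_nonzero[OF assms(1)] by (auto simp: null_sets_def)
qed (use that in blast)

lemma set_integral_strict_mono_AE:
  fixes f g :: "'a \<Rightarrow> real"
  assumes "set_integrable M A f" and "set_integrable M A g"
    and "A \<in> sets M" and "emeasure M A \<noteq> 0"
    and "AE x in M. x \<in> A \<longrightarrow> f x < g x"
  shows "(LINT x:A|M. f x) < (LINT x:A|M. g x)"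
proof -
  let ?D = "\<lambda>x. indicator A x *\<^sub>R (g x - f x)"
  have D: "integrable M ?D"
    using set_integral_diff(1)[OF assms(2,1)] by (simp add: set_integrable_def)
  have nonneg: "AE x in M. 0 \<le> ?D x"
    using assms(5) by eventually_elim (auto simp: indicator_def)
  have "integral\<^sup>L M ?D \<noteq> 0"
  proof
    assume "integral\<^sup>L M ?D = 0"
    then have "AE x in M. ?D x = 0"
      using integral_nonneg_eq_0_iff_AE[OF D nonneg] by simp
    with assms(5) have "AE x in M. x \<notin> A"
      by eventually_elim (auto simp: indicator_def)
    then show False
      using assms(3,4) AE_iff_null_sets[OF assms(3)] by (auto simp: null_sets_def)
  qed
  moreover have "0 \<le> integral\<^sup>L M ?D"
    using nonneg by (rule integral_nonneg_AE)
  ultimately have "0 < (LINT x:A|M. g x - f x)"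
    by (simp add: set_lebesgue_integral_def)
  then show ?thesis
    by (simp add: set_integral_diff(2)[OF assms(2,1)])
qed

lemma einterval_integral_add:
  fixes f :: "real \<Rightarrow> real"
  assumes "a < b" and "b < d" and f: "set_integrable lebesgue (einterval a d) f"
  shows "(LINT t:einterval a d|lebesgue. f t) =
    (LINT t:einterval a b|lebesgue. f t) + (LINT t:einterval b d|lebesgue. f t)"
proof -
  have sub: "einterval a b \<subseteq> einterval a d" "einterval b d \<subseteq> einterval a d"
    using assms(1,2) by (auto simp: einterval_iff)
  have int: "set_integrable lebesgue (einterval a b) f" "set_integrable lebesgue (einterval b d) f"
    using set_integrable_subset[OF f _ sub(1)] set_integrable_subset[OF f _ sub(2)] by auto
  have "set_integrable lebesgue (einterval a b \<union> einterval b d) f"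
    using int by (intro set_integrable_Un) auto
  \<comment> \<open>The two parts miss only the point \<open>b\<close>, which is finite because \<open>a < b < d\<close>.\<close>
  moreover have "AE t in lebesgue. t \<notin> {real_of_ereal b}"
    by (rule AE_not_in) (simp flip: negligible_iff_null_sets)
  then have "AE t in lebesgue. t \<in> einterval a b \<union> einterval b d \<longleftrightarrow> t \<in> einterval a d"
    by eventually_elim
       (use assms(1,2) sub in \<open>auto simp: einterval_iff; cases b; force\<close>)
  ultimately have "(LINT t:einterval a d|lebesgue. f t) =
      (LINT t:einterval a b \<union> einterval b d|lebesgue. f t)"
    using f by (intro set_integral_cong_set) (auto simp: set_integrable_def set_borel_measurable_def)
  also have "\<dots> = (LINT t:einterval a b|lebesgue. f t) + (LINT t:einterval b d|lebesgue. f t)"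
    using int by (intro set_integral_Un) (auto simp: einterval_iff)
  finally show ?thesis .
qed

lemma ereal_in_interval:
  assumes "ereal_interval I" and "a \<in> I" and "b \<in> I" and "t \<in> einterval a b"
  shows "ereal t \<in> I"
  using assms unfolding ereal_interval_def einterval_iff
  by (meson atLeastAtMost_iff less_imp_le subsetD)

lemma locally_lebesgue_integrable_einterval:
  assumes "ereal_interval I" and "locally_lebesgue_integrable I f" and "a \<in> I" and "b \<in> I"
  shows "set_integrable lebesgue (einterval a b) (\<lambda>t. f (ereal t))"
proof (rule set_integrable_subset)
  show "set_integrable lebesgue (ereal -` {a..b}) (\<lambda>t. f (ereal t))"
    using assms by (auto simp: ereal_interval_def locally_lebesgue_integrable_def)
qed (auto simp: einterval_iff)

section \<open>Means over adjacent intervals\<close>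

definition weighted_mean :: "(real \<Rightarrow> real) \<Rightarrow> (real \<Rightarrow> real) \<Rightarrow> ereal \<Rightarrow> ereal \<Rightarrow> real" where
  "weighted_mean f g a b =
     (LINT t:einterval a b|lebesgue. f t) / (LINT t:einterval a b|lebesgue. g t)"

lemma einterval_integral_pos:
  fixes g :: "real \<Rightarrow> real"
  assumes "a < b" and "set_integrable lebesgue (einterval a b) g"
    and "AE t in lebesgue. t \<in> einterval a b \<longrightarrow> 0 < g t"
  shows "0 < (LINT t:einterval a b|lebesgue. g t)"
  using set_integral_strict_mono_AE[of lebesgue "einterval a b" "\<lambda>_. 0" g]
    einterval_emeasure_nonzero[OF assms(1)] assms(2,3)
  by (simp add: set_integrable_def set_lebesgue_integral_def)

text \<open>
  The number \<open>m\<close> is the supremum of \<open>f / g\<close> on the left interval.  It is finite because the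
  quotient at a point of \<open>T\<close> in the right interval is an upper bound.  A strictly increasing
  quotient stays below \<open>m\<close> on the left interval, since to the right of any of its points there is
  a further point of \<open>T\<close> in this open interval, with a larger quotient.
\<close>

lemma integrals_separated:
  fixes f g :: "real \<Rightarrow> real"
  assumes ab: "a < b" and bd: "b < d"
    and f: "set_integrable lebesgue (einterval a d) f"
    and g: "set_integrable lebesgue (einterval a d) g"
    and T: "AE t in lebesgue. t \<in> einterval a d \<longrightarrow> t \<in> T"
    and pos: "\<And>t. t \<in> T \<Longrightarrow> 0 < g t"
    and mono: "mono_on T (\<lambda>t. f t / g t)"
  obtains m where
    "(LINT t:einterval a b|lebesgue. f t) \<le> m * (LINT t:einterval a b|lebesgue. g t)"
    "m * (LINT t:einterval b d|lebesgue. g t) \<le> (LINT t:einterval b d|lebesgue. f t)"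
    "strict_mono_on T (\<lambda>t. f t / g t) \<Longrightarrow>
       (LINT t:einterval a b|lebesgue. f t) < m * (LINT t:einterval a b|lebesgue. g t)"
proof -
  let ?h = "\<lambda>t. f t / g t" and ?A = "einterval a b" and ?B = "einterval b d"
  have sub: "?A \<subseteq> einterval a d" "?B \<subseteq> einterval a d"
    using ab bd by (auto simp: einterval_iff)
  have fA: "set_integrable lebesgue ?A f" and gA: "set_integrable lebesgue ?A g"
    and fB: "set_integrable lebesgue ?B f" and gB: "set_integrable lebesgue ?B g"
    using set_integrable_subset[OF f] set_integrable_subset[OF g] sub by auto
  have TA: "AE t in lebesgue. t \<in> ?A \<longrightarrow> t \<in> T" and TB: "AE t in lebesgue. t \<in> ?B \<longrightarrow> t \<in> T"
    using T sub by (auto elim!: eventually_mono)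
  obtain t0 where t0: "t0 \<in> ?A" "t0 \<in> T"
    using AE_einterval_witness[OF ab TA] by blast
  obtain t1 where t1: "t1 \<in> ?B" "t1 \<in> T"
    using AE_einterval_witness[OF bd TB] by blast
  have le: "?h s \<le> ?h t" if "s \<in> ?A" "s \<in> T" "t \<in> ?B" "t \<in> T" for s t
  proof -
    have "ereal s < ereal t"
      using that(1,3) unfolding einterval_iff by (meson less_trans)
    then show ?thesis
      using mono_onD[OF mono that(2,4)] by simp
  qed
  define m where "m = Sup (?h ` (?A \<inter> T))"
  have bdd: "bdd_above (?h ` (?A \<inter> T))"
    using le t1 by (intro bdd_aboveI[of _ "?h t1"]) auto
  have upper: "?h t \<le> m" if "t \<in> ?A" "t \<in> T" for t
    unfolding m_def using bdd that by (intro cSup_upper) auto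
  have lower: "m \<le> ?h t" if "t \<in> ?B" "t \<in> T" for t
    unfolding m_def using le that t0 by (intro cSup_least) auto
  have mult: "(LINT t:E|lebesgue. m * g t) = m * (LINT t:E|lebesgue. g t)" for E
    by simp
  have mg: "set_integrable lebesgue E (\<lambda>t. m * g t)" if "set_integrable lebesgue E g" for E
    using that by (intro set_integrable_mult_right) auto
  show ?thesis
  proof
    have "AE t in lebesgue. t \<in> ?A \<longrightarrow> f t \<le> m * g t"
      using TA by eventually_elim (use upper pos in \<open>auto simp: pos_divide_le_eq\<close>)
    then show "(LINT t:?A|lebesgue. f t) \<le> m * (LINT t:?A|lebesgue. g t)"
      unfolding mult[symmetric] by (rule set_integral_mono_AE[OF fA mg[OF gA]])
    have "AE t in lebesgue. t \<in> ?B \<longrightarrow> m * g t \<le> f t"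
      using TB by eventually_elim (use lower pos in \<open>auto simp: pos_le_divide_eq\<close>)
    then show "m * (LINT t:?B|lebesgue. g t) \<le> (LINT t:?B|lebesgue. f t)"
      unfolding mult[symmetric] by (rule set_integral_mono_AE[OF mg[OF gB] fB])
  next
    assume strict: "strict_mono_on T ?h"
    have "?h t < m" if t: "t \<in> ?A" "t \<in> T" for t
    proof -
      have "ereal t < b"
        using t by (simp add: einterval_iff)
      moreover have "einterval (ereal t) b \<subseteq> ?A"
        using t(1) unfolding einterval_iff subset_iff by (meson less_trans)
      with TA have "AE s in lebesgue. s \<in> einterval (ereal t) b \<longrightarrow> s \<in> T"
        by (auto elim!: eventually_mono)
      ultimately obtain s where s: "s \<in> einterval (ereal t) b" "s \<in> T"
        by (rule AE_einterval_witness)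
      have "?h t < ?h s"
        using s t by (intro strict_mono_onD[OF strict]) (auto simp: einterval_iff)
      also have "\<dots> \<le> m"
        using s t by (intro upper) (auto simp: einterval_iff intro: less_trans[of a "ereal t"])
      finally show ?thesis .
    qed
    with TA have "AE t in lebesgue. t \<in> ?A \<longrightarrow> f t < m * g t"
      by (auto elim!: eventually_mono simp: pos pos_divide_less_eq[symmetric])
    then show "(LINT t:?A|lebesgue. f t) < m * (LINT t:?A|lebesgue. g t)"
      unfolding mult[symmetric] using einterval_emeasure_nonzero[OF ab]
      by (intro set_integral_strict_mono_AE[OF fA mg[OF gA]]) auto
  qed
qed

lemma mediant_between:
  fixes A B C D m :: real
  assumes "0 < C" "0 < D" "A \<le> m * C" "m * D \<le> B"
  shows "A / C \<le> (A + B) / (C + D)" and "(A + B) / (C + D) \<le> B / D"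
    and "A < m * C \<Longrightarrow> A / C < (A + B) / (C + D)"
    and "A < m * C \<Longrightarrow> (A + B) / (C + D) < B / D"
proof -
  have CD: "0 < C + D"
    using assms by simp
  have 1: "A * D \<le> m * C * D" and 2: "m * C * D \<le> B * C"
    using mult_right_mono[OF assms(3), of D] mult_right_mono[OF assms(4), of C] assms(1,2)
    by (simp_all add: mult_ac)
  have "A * D \<le> B * C"
    using 1 2 by (rule order_trans)
  then show "A / C \<le> (A + B) / (C + D)" "(A + B) / (C + D) \<le> B / D"
    using assms(1,2) CD by (simp_all add: field_simps)
  assume "A < m * C"
  then have "A * D < m * C * D"
    using assms by simp
  then have "A * D < B * C"
    using 2 by (rule less_le_trans)
  then show "A / C < (A + B) / (C + D)" "(A + B) / (C + D) < B / D"
    using assms(1,2) CD by (simp_all add: field_simps)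
qed

lemma mean_between:
  fixes f g :: "real \<Rightarrow> real"
  assumes ab: "a < b" and bd: "b < d"
    and f: "set_integrable lebesgue (einterval a d) f"
    and g: "set_integrable lebesgue (einterval a d) g"
    and T: "AE t in lebesgue. t \<in> einterval a d \<longrightarrow> t \<in> T"
    and pos: "\<And>t. t \<in> T \<Longrightarrow> 0 < g t"
  shows "mono_on T (\<lambda>t. f t / g t) \<Longrightarrow>
      weighted_mean f g a b \<le> weighted_mean f g a d \<and>
      weighted_mean f g a d \<le> weighted_mean f g b d"
    and "strict_mono_on T (\<lambda>t. f t / g t) \<Longrightarrow>
      weighted_mean f g a b < weighted_mean f g a d \<and>
      weighted_mean f g a d < weighted_mean f g b d"
proof -
  have sub: "einterval a b \<subseteq> einterval a d" "einterval b d \<subseteq> einterval a d"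
    using ab bd by (auto simp: einterval_iff)
  have G: "0 < (LINT t:einterval a b|lebesgue. g t)" "0 < (LINT t:einterval b d|lebesgue. g t)"
    using ab bd set_integrable_subset[OF g _ sub(1)] set_integrable_subset[OF g _ sub(2)] T sub pos
    by (auto intro!: einterval_integral_pos elim!: eventually_mono)
  note add = einterval_integral_add[OF ab bd f] einterval_integral_add[OF ab bd g]
  {
    assume mono: "mono_on T (\<lambda>t. f t / g t)"
    obtain m where m: "(LINT t:einterval a b|lebesgue. f t) \<le> m * (LINT t:einterval a b|lebesgue. g t)"
      "m * (LINT t:einterval b d|lebesgue. g t) \<le> (LINT t:einterval b d|lebesgue. f t)"
      using integrals_separated[OF ab bd f g T pos mono] by blast
    show "weighted_mean f g a b \<le> weighted_mean f g a d \<and>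
        weighted_mean f g a d \<le> weighted_mean f g b d"
      using mediant_between(1,2)[OF G m] by (simp add: weighted_mean_def add)
  }
  {
    assume strict: "strict_mono_on T (\<lambda>t. f t / g t)"
    obtain m where m: "(LINT t:einterval a b|lebesgue. f t) \<le> m * (LINT t:einterval a b|lebesgue. g t)"
      "m * (LINT t:einterval b d|lebesgue. g t) \<le> (LINT t:einterval b d|lebesgue. f t)"
      "(LINT t:einterval a b|lebesgue. f t) < m * (LINT t:einterval a b|lebesgue. g t)"
      using integrals_separated[OF ab bd f g T pos strict_mono_on_imp_mono_on[OF strict]] strict
      by blast
    show "weighted_mean f g a b < weighted_mean f g a d \<and>
        weighted_mean f g a d < weighted_mean f g b d"
      using mediant_between(3,4)[OF G m] by (simp add: weighted_mean_def add)
  }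
qed

section \<open>Monotonicity of the quotient of the integrals\<close>

text \<open>For \<open>x < c\<close> both oriented integrals carry a minus sign, which cancels in the quotient.\<close>

lemma integral_quotient_eq_mean:
  "integral_quotient c f g x =
     weighted_mean (\<lambda>t. f (ereal t)) (\<lambda>t. g (ereal t)) (min c x) (max c x)"
  by (auto simp: integral_quotient_def weighted_mean_def interval_lebesgue_integral_def min_def max_def)

text \<open>
  The relation \<open>R\<close> stands for \<open>\<le>\<close> or \<open><\<close>.  Transitivity is needed for points on different sides
  of \<open>c\<close>, which are compared through the mean over the whole interval between them.
\<close>

lemma integral_quotient_monotone_from_means:
  assumes "c \<in> I" and "transp R"
    and between: "\<And>a b d. a \<in> I \<Longrightarrow> b \<in> I \<Longrightarrow> d \<in> I \<Longrightarrow> a < b \<Longrightarrow> b < d \<Longrightarrow>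
      R (weighted_mean (\<lambda>t. f (ereal t)) (\<lambda>t. g (ereal t)) a b)
        (weighted_mean (\<lambda>t. f (ereal t)) (\<lambda>t. g (ereal t)) a d) \<and>
      R (weighted_mean (\<lambda>t. f (ereal t)) (\<lambda>t. g (ereal t)) a d)
        (weighted_mean (\<lambda>t. f (ereal t)) (\<lambda>t. g (ereal t)) b d)"
  shows "monotone_on (I - {c}) (<) R (integral_quotient c f g)"
proof (rule monotone_onI)
  fix x y assume xy: "x \<in> I - {c}" "y \<in> I - {c}" "x < y"
  consider "c < x" | "x < c" "c < y" | "y < c"
    using xy by fastforce
  then show "R (integral_quotient c f g x) (integral_quotient c f g y)"
  proof cases
    case 1
    then show ?thesis
      using between[of c x y] xy \<open>c \<in> I\<close> by (simp add: integral_quotient_eq_mean min_absorb1 max_absorb2)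
  next
    case 2
    then show ?thesis
      using between[of x c y] xy \<open>c \<in> I\<close>
      by (auto simp: integral_quotient_eq_mean min_absorb1 min_absorb2 max_absorb1 max_absorb2
          intro: transpD[OF \<open>transp R\<close>])
  next
    case 3
    then show ?thesis
      using between[of x y c] xy \<open>c \<in> I\<close> by (simp add: integral_quotient_eq_mean min_absorb2 max_absorb1)
  qed
qed

lemma integral_quotient_mono_pos:
  assumes I: "ereal_interval I" and c: "c \<in> I"
    and f: "locally_lebesgue_integrable I f" and g: "locally_lebesgue_integrable I g"
    and T: "AE t in lebesgue. ereal t \<in> I \<longrightarrow> t \<in> T"
    and pos: "\<And>t. t \<in> T \<Longrightarrow> 0 < g (ereal t)"
  shows "mono_on T (\<lambda>t. f (ereal t) / g (ereal t)) \<Longrightarrow>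
      mono_on (I - {c}) (integral_quotient c f g)"
    and "strict_mono_on T (\<lambda>t. f (ereal t) / g (ereal t)) \<Longrightarrow>
      strict_mono_on (I - {c}) (integral_quotient c f g)"
proof -
  have TI: "AE t in lebesgue. t \<in> einterval a d \<longrightarrow> t \<in> T" if "a \<in> I" "d \<in> I" for a d
    using T by (auto elim!: eventually_mono intro: ereal_in_interval[OF I that])
  note int = locally_lebesgue_integrable_einterval[OF I f] locally_lebesgue_integrable_einterval[OF I g]
  {
    assume mono: "mono_on T (\<lambda>t. f (ereal t) / g (ereal t))"
    have "monotone_on (I - {c}) (<) (\<le>) (integral_quotient c f g)"
      by (rule integral_quotient_monotone_from_means[OF c])
         (simp, rule mean_between(1)[OF _ _ int TI pos mono])
    then show "mono_on (I - {c}) (integral_quotient c f g)"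
      by (auto simp: monotone_on_def le_less)
  }
  {
    assume strict: "strict_mono_on T (\<lambda>t. f (ereal t) / g (ereal t))"
    show "strict_mono_on (I - {c}) (integral_quotient c f g)"
      by (rule integral_quotient_monotone_from_means[OF c])
         (simp, rule mean_between(2)[OF _ _ int TI pos strict])
  }
qed

lemma locally_lebesgue_integrable_uminus:
  "locally_lebesgue_integrable I f \<Longrightarrow> locally_lebesgue_integrable I (\<lambda>x. - f x)"
  by (auto simp: locally_lebesgue_integrable_def set_integrable_def)

lemma integral_quotient_uminus:
  "integral_quotient c (\<lambda>x. - f x) g x = - integral_quotient c f g x"
  "integral_quotient c (\<lambda>x. - f x) (\<lambda>x. - g x) = integral_quotient c f g"
  by (simp_all add: fun_eq_iff integral_quotient_def interval_lebesgue_integral_uminus)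

lemma integral_quotient_mono:
  assumes I: "ereal_interval I" and c: "c \<in> I"
    and f: "locally_lebesgue_integrable I f" and g: "locally_lebesgue_integrable I g"
    and sign: "ae_nonzero_sign I g"
    and T: "AE t in lebesgue. ereal t \<in> I \<longrightarrow> t \<in> T"
  shows "mono_on T (\<lambda>t. f (ereal t) / g (ereal t)) \<Longrightarrow>
      mono_on (I - {c}) (integral_quotient c f g)"
    and "strict_mono_on T (\<lambda>t. f (ereal t) / g (ereal t)) \<Longrightarrow>
      strict_mono_on (I - {c}) (integral_quotient c f g)"
proof -
  have "(mono_on T (\<lambda>t. f (ereal t) / g (ereal t)) \<longrightarrow>
        mono_on (I - {c}) (integral_quotient c f g)) \<and>
      (strict_mono_on T (\<lambda>t. f (ereal t) / g (ereal t)) \<longrightarrow>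
        strict_mono_on (I - {c}) (integral_quotient c f g))"
    using sign unfolding ae_nonzero_sign_def
  proof (elim disjE)
    let ?T = "T \<inter> {t. 0 < g (ereal t)}"
    assume "AE t in lebesgue. ereal t \<in> I \<longrightarrow> g (ereal t) > 0"
    with T have "AE t in lebesgue. ereal t \<in> I \<longrightarrow> t \<in> ?T"
      by eventually_elim auto
    from integral_quotient_mono_pos[OF I c f g this] show ?thesis
      by (auto intro: monotone_on_subset)
  next
    let ?T = "T \<inter> {t. g (ereal t) < 0}"
    assume "AE t in lebesgue. ereal t \<in> I \<longrightarrow> g (ereal t) < 0"
    with T have "AE t in lebesgue. ereal t \<in> I \<longrightarrow> t \<in> ?T"
      by eventually_elim auto
    from integral_quotient_mono_pos[OF I c locally_lebesgue_integrable_uminus[OF f]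
        locally_lebesgue_integrable_uminus[OF g] this]
    show ?thesis
      by (auto simp: integral_quotient_uminus(2) intro: monotone_on_subset)
  qed
  then show "mono_on T (\<lambda>t. f (ereal t) / g (ereal t)) \<Longrightarrow>
      mono_on (I - {c}) (integral_quotient c f g)"
    and "strict_mono_on T (\<lambda>t. f (ereal t) / g (ereal t)) \<Longrightarrow>
      strict_mono_on (I - {c}) (integral_quotient c f g)"
    by auto
qed

text \<open>
  At a zero of \<open>g\<close> the extended real quotient may be infinite and differs from the real one,
  so the zeros of \<open>g\<close> join the exceptional null set when passing to real quotients.
\<close>

lemma real_quotient_monotone:
  assumes "ae_nonzero_sign I g"
    and "ae_restricted I (\<lambda>S. monotone_on S Q R (pointwise_quotient f g))"
  obtains T where "AE t in lebesgue. ereal t \<in> I \<longrightarrow> t \<in> T"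
    and "monotone_on T (\<lambda>s t. Q (ereal s) (ereal t)) (\<lambda>u v. R (ereal u) (ereal v))
      (\<lambda>t. f (ereal t) / g (ereal t))"
proof -
  obtain N where N: "ereal -` N \<in> null_sets lebesgue"
    and mono: "monotone_on (I - N) Q R (pointwise_quotient f g)"
    using assms(2) by (auto simp: ae_restricted_def)
  let ?T = "{t. ereal t \<in> I - N \<and> g (ereal t) \<noteq> 0}"
  have "AE t in lebesgue. ereal t \<in> I \<longrightarrow> g (ereal t) \<noteq> 0"
    using assms(1) unfolding ae_nonzero_sign_def by (auto elim!: eventually_mono)
  with AE_not_in[OF N] have "AE t in lebesgue. ereal t \<in> I \<longrightarrow> t \<in> ?T"
    by eventually_elim auto
  moreover have "monotone_on ?T (\<lambda>s t. Q (ereal s) (ereal t)) (\<lambda>u v. R (ereal u) (ereal v))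
      (\<lambda>t. f (ereal t) / g (ereal t))"
  proof (rule monotone_onI)
    fix s t assume st: "s \<in> ?T" "t \<in> ?T" "Q (ereal s) (ereal t)"
    then have "R (pointwise_quotient f g (ereal s)) (pointwise_quotient f g (ereal t))"
      by (intro monotone_onD[OF mono]) auto
    then show "R (ereal (f (ereal s) / g (ereal s))) (ereal (f (ereal t) / g (ereal t)))"
      using st by (simp add: pointwise_quotient_def)
  qed
  ultimately show ?thesis
    by (rule that)
qed

lemma interval_integral_nonzero:
  assumes I: "ereal_interval I" and "c \<in> I" "x \<in> I" "x \<noteq> c"
    and g: "locally_lebesgue_integrable I g" and sign: "ae_nonzero_sign I g"
  shows "(LINT t=c..x|lebesgue. g (ereal t)) \<noteq> 0"
proof -
  have nz: "(LINT t:einterval a b|lebesgue. g (ereal t)) \<noteq> 0" if "a \<in> I" "b \<in> I" "a < b" for a b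
  proof -
    note sub = ereal_in_interval[OF I that(1,2)]
    have int: "set_integrable lebesgue (einterval a b) (\<lambda>t. g (ereal t))"
      "set_integrable lebesgue (einterval a b) (\<lambda>t. - g (ereal t))"
      using locally_lebesgue_integrable_einterval[OF I _ that(1,2)] g
        locally_lebesgue_integrable_uminus[OF g] by blast+
    show ?thesis
      using sign unfolding ae_nonzero_sign_def
    proof (elim disjE)
      assume "AE t in lebesgue. ereal t \<in> I \<longrightarrow> g (ereal t) > 0"
      then have "AE t in lebesgue. t \<in> einterval a b \<longrightarrow> 0 < g (ereal t)"
        using sub by (auto elim!: eventually_mono)
      from einterval_integral_pos[OF that(3) int(1) this] show ?thesis
        by simp
    next
      assume "AE t in lebesgue. ereal t \<in> I \<longrightarrow> g (ereal t) < 0"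
      then have "AE t in lebesgue. t \<in> einterval a b \<longrightarrow> 0 < - g (ereal t)"
        using sub by (auto elim!: eventually_mono)
      from einterval_integral_pos[OF that(3) int(2) this] show ?thesis
        by (simp add: set_integral_uminus[OF int(1)])
    qed
  qed
  show ?thesis
    using nz[of c x] nz[of x c] assms by (auto simp: interval_lebesgue_integral_def)
qed

theorem theorem1:
  fixes I :: "ereal set" and c :: ereal and f g :: "ereal \<Rightarrow> real"
  assumes "ereal_interval I"
    and "c \<in> I"
    and "locally_lebesgue_integrable I f"
    and "locally_lebesgue_integrable I g"
    and "ae_nonzero_sign I g"
  shows "(\<forall>x\<in>I - {c}. (LINT t=c..x|lebesgue. g (ereal t)) \<noteq> 0) \<and>
    (ae_restricted I (\<lambda>S. mono_on S (pointwise_quotient f g)) \<longrightarrow>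
       mono_on (I - {c}) (integral_quotient c f g)) \<and>
    (ae_restricted I (\<lambda>S. antimono_on S (pointwise_quotient f g)) \<longrightarrow>
       antimono_on (I - {c}) (integral_quotient c f g)) \<and>
    (ae_restricted I (\<lambda>S. strict_mono_on S (pointwise_quotient f g)) \<longrightarrow>
       strict_mono_on (I - {c}) (integral_quotient c f g)) \<and>
    (ae_restricted I (\<lambda>S. strict_antimono_on S (pointwise_quotient f g)) \<longrightarrow>
       strict_antimono_on (I - {c}) (integral_quotient c f g))"
proof (intro conjI impI ballI)
  note mono = integral_quotient_mono[OF assms]
  note mono_neg = integral_quotient_mono[OF assms(1,2)
      locally_lebesgue_integrable_uminus[OF assms(3)] assms(4,5)]
  show "(LINT t=c..x|lebesgue. g (ereal t)) \<noteq> 0" if "x \<in> I - {c}" for x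
    using that interval_integral_nonzero[OF assms(1,2) _ _ assms(4,5)] by auto
  show "mono_on (I - {c}) (integral_quotient c f g)"
    if "ae_restricted I (\<lambda>S. mono_on S (pointwise_quotient f g))"
    using real_quotient_monotone[OF assms(5) that] mono(1) by auto
  show "strict_mono_on (I - {c}) (integral_quotient c f g)"
    if "ae_restricted I (\<lambda>S. strict_mono_on S (pointwise_quotient f g))"
    using real_quotient_monotone[OF assms(5) that] mono(2) by auto
  show "antimono_on (I - {c}) (integral_quotient c f g)"
    if anti: "ae_restricted I (\<lambda>S. antimono_on S (pointwise_quotient f g))"
  proof -
    obtain T where T: "AE t in lebesgue. ereal t \<in> I \<longrightarrow> t \<in> T"
      and "antimono_on T (\<lambda>t. f (ereal t) / g (ereal t))"
      using real_quotient_monotone[OF assms(5) anti] by auto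
    then have "mono_on T (\<lambda>t. - f (ereal t) / g (ereal t))"
      by (auto simp: monotone_on_def)
    from mono_neg(1)[OF T this] show ?thesis
      by (auto simp: integral_quotient_uminus(1) monotone_on_def)
  qed
  show "strict_antimono_on (I - {c}) (integral_quotient c f g)"
    if anti: "ae_restricted I (\<lambda>S. strict_antimono_on S (pointwise_quotient f g))"
  proof -
    obtain T where T: "AE t in lebesgue. ereal t \<in> I \<longrightarrow> t \<in> T"
      and "strict_antimono_on T (\<lambda>t. f (ereal t) / g (ereal t))"
      using real_quotient_monotone[OF assms(5) anti] by auto
    then have "strict_mono_on T (\<lambda>t. - f (ereal t) / g (ereal t))"
      by (auto simp: monotone_on_def)
    from mono_neg(2)[OF T this] show ?thesis
      by (auto simp: integral_quotient_uminus(1) monotone_on_def)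
  qed
qed

end
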